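(* Let $R=\mathbb{Z}_2[x,y,x^{-1},y^{-1}]$, let $f,g\in R$, let $\alpha,\beta\ge1$ and $\gamma$ be integers. On the torus with twisted periodic boundary condition labeled by $\vec a_1=(0,\alpha)$ and $\vec a_2=(\beta,\gamma)$, the stabilizer code defined by $f$ and $g$ has logical dimension $$k=2\,\dim_{\mathbb{Z}_2}\left(\frac{\mathbb{Z}_2[x,y,x^{-1},y^{-1}]}{\langle f(x,y),\;g(x,y),\;y^\alpha-1,\;x^\beta y^\gamma-1\rangle}\right).$$
   Context: The code. $R=\mathbb{Z}_2[x,y,x^{-1},y^{-1}]$ is the Laurent polynomial ring over the field with two elements. For $p\in R$, $\overline{p}$ is the image of $p$ under the $\mathbb{Z}_2$-linear antipode map $x^ny^m\mapsto x^{-n}y^{-m}$. On the square lattice with two qubits per unit cell (cells indexed by $\mathbb{Z}^2$), Pauli operators of pure $X$-type (or pure $Z$-type) are encoded as elements of $R^2$, the coefficient of $x^ny^m$ in the $i$-th component indicating whether the operator acts on the $i$-th qubit of cell $(n,m)$. Given $f,g\in R$, the translation-invariant CSS stabilizer code defined by $f,g$ has $X$-stabilizer generators all $x^ny^m\,(f,g)$ and $Z$-stabilizer generators all $x^ny^m\,(\overline{g},\overline{f})$, $n,m\in\mathbb{Z}$. Torus. The (twisted) torus with lattice vectors $\vec a_1=(0,\alpha)$, $\vec a_2=(\beta,\gamma)$ is obtained by identifying cells that differ by an element of the lattice generated by $\vec a_1,\vec a_2$; algebraically $R$ is replaced by $S=R/\langle y^\alpha-1,\;x^\beta y^\gamma-1\rangle$,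 of $\mathbb{Z}_2$-dimension $\alpha\beta$. The code on this torus has $n=2\alpha\beta$ physical qubits. Logical dimension. $k=n-\dim_{\mathbb{Z}_2}\{(sf,sg):s\in S\}-\dim_{\mathbb{Z}_2}\{(s\overline{g},s\overline{f}):s\in S\}$ (subspaces of $S^2$), i.e. $n-\operatorname{rank}H_X-\operatorname{rank}H_Z$ for the parity-check matrices of the $X$- and $Z$-stabilizers. *)

theory Defs
  imports
    "HOL-Library.Poly_Mapping"
    "HOL-Library.Z2"
    "HOL-Library.Product_Plus"
    "HOL-Algebra.Algebraic_Closure_Type"
    "HOL-Algebra.Chinese_Remainder"
begin

text \<open>
  The Laurent polynomial ring in two variables over the field with two elements is the group
  algebra of the additive group of exponent vectors; the product of poly_mapping is convolution.
\<close>

type_synonym laurent = "(int \<times> int) \<Rightarrow>\<^sub>0 bit"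

abbreviation laurent_ring :: "laurent ring"
  where "laurent_ring \<equiv> ring_of_type_algebra"

definition monomial :: "int \<Rightarrow> int \<Rightarrow> laurent"  \<comment> \<open>x to the n times y to the m\<close>
  where "monomial n m = Poly_Mapping.single (n, m) 1"

text \<open>The coefficient of the antipode at an exponent vector v is the coefficient of p at -v.\<close>

definition antipode :: "laurent \<Rightarrow> laurent"
  where "antipode p = Poly_Mapping.map_key uminus p"

lemma antipode_zero: "antipode 0 = 0"
  by (simp add: antipode_def)

lemma antipode_add: "antipode (p + q) = antipode p + antipode q"
  by (simp add: antipode_def map_key_plus)

lemma antipode_monomial: "antipode (monomial n m) = monomial (- n) (- m)"
proof -
  have "Poly_Mapping.map_key uminus (Poly_Mapping.single (- (- n, - m)) 1)
          = Poly_Mapping.single (- n, - m) (1 :: bit)"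
    by (rule map_key_single) simp
  then show ?thesis by (simp add: antipode_def monomial_def)
qed

definition laurent_quot :: "laurent set \<Rightarrow> laurent set ring"
  where "laurent_quot A = laurent_ring Quot (Idl\<^bsub>laurent_ring\<^esub> A)"

definition torus_relations :: "int \<Rightarrow> int \<Rightarrow> int \<Rightarrow> laurent set"
  where "torus_relations \<alpha> \<beta> \<gamma> = {monomial 0 \<alpha> - 1, monomial \<beta> \<gamma> - 1}"

definition torus :: "int \<Rightarrow> int \<Rightarrow> int \<Rightarrow> laurent set ring"
  where "torus \<alpha> \<beta> \<gamma> = laurent_quot (torus_relations \<alpha> \<beta> \<gamma>)"

definition torus_proj :: "int \<Rightarrow> int \<Rightarrow> int \<Rightarrow> laurent \<Rightarrow> laurent set"
  where "torus_proj \<alpha> \<beta> \<gamma> p = Idl\<^bsub>laurent_ring\<^esub> (torus_relations \<alpha> \<beta> \<gamma>) +>\<^bsub>laurent_ring\<^esub> p"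

text \<open>
  Dimension over the field with two elements of a subspace E of a ring A of characteristic two:
  the scalars are the prime subring of A, which consists of zero and one only.  In a direct product
  of two such rings these scalars are (0, 0) and (1, 1), so the scalar action is componentwise.
  If A is the zero ring, the dimension is 0.
\<close>

definition dim_Z2 :: "'a ring \<Rightarrow> 'a set \<Rightarrow> nat"
  where "dim_Z2 A E = ring.dim A {\<zero>\<^bsub>A\<^esub>, \<one>\<^bsub>A\<^esub>} E"

text \<open>
  The span of all torus translates of the X-type generator (f, g), and of the Z-type generator
  (antipode g, antipode f), as subspaces of the square of the torus ring.
\<close>

definition X_stabilizers ::
    "int \<Rightarrow> int \<Rightarrow> int \<Rightarrow> laurent \<Rightarrow> laurent \<Rightarrow> (laurent set \<times> laurent set) set"
  where "X_stabilizers \<alpha> \<beta> \<gamma> f g =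
    (let S = torus \<alpha> \<beta> \<gamma>; \<pi> = torus_proj \<alpha> \<beta> \<gamma>
     in {(s \<otimes>\<^bsub>S\<^esub> \<pi> f, s \<otimes>\<^bsub>S\<^esub> \<pi> g) | s. s \<in> carrier S})"

definition Z_stabilizers ::
    "int \<Rightarrow> int \<Rightarrow> int \<Rightarrow> laurent \<Rightarrow> laurent \<Rightarrow> (laurent set \<times> laurent set) set"
  where "Z_stabilizers \<alpha> \<beta> \<gamma> f g =
    (let S = torus \<alpha> \<beta> \<gamma>; \<pi> = torus_proj \<alpha> \<beta> \<gamma>
     in {(s \<otimes>\<^bsub>S\<^esub> \<pi> (antipode g), s \<otimes>\<^bsub>S\<^esub> \<pi> (antipode f)) | s. s \<in> carrier S})"

definition num_qubits :: "int \<Rightarrow> int \<Rightarrow> int"  \<comment> \<open>two for each of the \<open>\<alpha> * \<beta>\<close> cells\<close>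
  where "num_qubits \<alpha> \<beta> = 2 * \<alpha> * \<beta>"

definition logical_dimension :: "int \<Rightarrow> int \<Rightarrow> int \<Rightarrow> laurent \<Rightarrow> laurent \<Rightarrow> int"
  where "logical_dimension \<alpha> \<beta> \<gamma> f g =
    (let S2 = RDirProd (torus \<alpha> \<beta> \<gamma>) (torus \<alpha> \<beta> \<gamma>)
     in num_qubits \<alpha> \<beta>
        - int (dim_Z2 S2 (X_stabilizers \<alpha> \<beta> \<gamma> f g))
        - int (dim_Z2 S2 (Z_stabilizers \<alpha> \<beta> \<gamma> f g)))"

end

theory Submission
  imports Defs
begin

text \<open>
  A finite vector space over the field with two elements has cardinality 2 to its dimension, so all
  dimensions can be computed by counting.  Write S for the torus ring and I for its ideal generated
  by f and g.  The X-stabilizer space is the image of S under \<open>s \<mapsto> (s f, s g)\<close>, whose kernel is the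
  annihilator of I, and the ring on the right-hand side of the theorem is S / I.  The form sending
  a, b to the constant coefficient of a b is nondegenerate on S, and the orthogonal complement of I
  with respect to it is the annihilator of I; hence this annihilator has as many elements as S / I,
  and the X-stabilizer space as many as I.  The antipode maps the X-stabilizers bijectively onto the
  Z-stabilizers.
\<close>

section \<open>Finite subspaces over the prime field\<close>

text \<open>Counting is preferred to linear maps because the quotient by f and g may be the zero
  ring (for instance f = 1), where zero and one coincide and the scalars are no field; cardinalities
  treat this case like all others. Nondegeneracy of the form comes from S being the group algebra of
  the finite group of cells: multiplication by an inverse monomial moves any coefficient to the
  constant position. The difficulty is to show that the relations do not identify more than
  intended, since nonmembership in a generated ideal has no direct test. The radical of the form,
  computed upstairs in the Laurent ring, supplies one: it is an ideal containing the relations,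
  hence it bounds their ideal from above, and no nonempty sum of distinct cells lies in it. This one
  bound yields the size of S as well as the nondegeneracy. The theorem then follows from dim X =
  \<alpha> \<beta> - dim (S / I) and dim Z = dim X.\<close>

lemma (in ring) line_extension_prime_field:
  assumes "v \<in> carrier R" "E \<subseteq> carrier R"
  shows "line_extension {\<zero>, \<one>} v E = E \<union> (\<lambda>e. v \<oplus> e) ` E"
proof -
  have 1: "{\<zero>, \<one>} #> v = {\<zero>, v}"
    using assms by (auto simp: r_coset_def)
  show ?thesis
    using assms unfolding line_extension_def 1 set_add_def'
    by (force simp: subset_iff image_iff)
qed

text \<open>The extension consists of E and the single coset v + E. These are disjoint because v
  lies outside E, and v + v = 0 makes their union closed under addition.\<close>

lemma (in ring) line_extension_card_subgroup:
  assumes char2: "\<And>x. x \<in> carrier R \<Longrightarrow> x \<oplus> x = \<zero>"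
    and v: "v \<in> carrier R" "v \<notin> E" and E: "additive_subgroup E R" "finite E"
  shows "additive_subgroup (line_extension {\<zero>, \<one>} v E) R"
    and "finite (line_extension {\<zero>, \<one>} v E)"
    and "card (line_extension {\<zero>, \<one>} v E) = 2 * card E"
proof -
  interpret E: additive_subgroup E R by fact
  have sub: "E \<subseteq> carrier R" by (rule E.a_subset)
  have eq: "line_extension {\<zero>, \<one>} v E = E \<union> (\<lambda>e. v \<oplus> e) ` E"
    by (rule line_extension_prime_field) (use v sub in auto)
  have inv: "\<ominus> x = x" if "x \<in> carrier R" for x
    using char2 that minus_equality by blast
  have vv: "v \<oplus> (v \<oplus> e) = e" if "e \<in> carrier R" for e
    using that v char2 by (metis a_assoc l_zero)
  have disj: "E \<inter> (\<lambda>e. v \<oplus> e) ` E = {}"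
  proof (rule ccontr)
    assume "E \<inter> (\<lambda>e. v \<oplus> e) ` E \<noteq> {}"
    then obtain e where e: "e \<in> E" "v \<oplus> e \<in> E" by auto
    then have "(v \<oplus> e) \<oplus> e \<in> E" by auto
    moreover have "(v \<oplus> e) \<oplus> e = v"
      using e sub v char2 by (metis a_assoc r_zero subsetD)
    ultimately show False using v by simp
  qed
  have inj: "inj_on (\<lambda>e. v \<oplus> e) E"
    by (rule inj_on_inverseI[of _ "\<lambda>e. v \<oplus> e"]) (use vv sub in blast)
  show "finite (line_extension {\<zero>, \<one>} v E)" using E by (simp add: eq)
  show "card (line_extension {\<zero>, \<one>} v E) = 2 * card E"
    using E disj inj by (simp add: eq card_Un_disjoint card_image)
  show "additive_subgroup (line_extension {\<zero>, \<one>} v E) R"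
  proof (rule additive_subgroupI, rule add.subgroupI)
    show carr: "line_extension {\<zero>, \<one>} v E \<subseteq> carrier R"
      using sub v by (auto simp: eq)
    show "line_extension {\<zero>, \<one>} v E \<noteq> {}"
      unfolding eq using E.zero_closed by blast
    show "\<ominus> a \<in> line_extension {\<zero>, \<one>} v E" if "a \<in> line_extension {\<zero>, \<one>} v E" for a
      using that inv[of a] carr by auto
    show "a \<oplus> b \<in> line_extension {\<zero>, \<one>} v E"
      if "a \<in> line_extension {\<zero>, \<one>} v E" "b \<in> line_extension {\<zero>, \<one>} v E" for a b
    proof -
      have "(v \<oplus> x) \<oplus> y = v \<oplus> (x \<oplus> y)" "x \<oplus> (v \<oplus> y) = v \<oplus> (x \<oplus> y)"
        "(v \<oplus> x) \<oplus> (v \<oplus> y) = x \<oplus> y" if "x \<in> E" "y \<in> E" for x y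
      proof -
        have xy: "x \<in> carrier R" "y \<in> carrier R" using that sub by auto
        show "(v \<oplus> x) \<oplus> y = v \<oplus> (x \<oplus> y)" "x \<oplus> (v \<oplus> y) = v \<oplus> (x \<oplus> y)"
          using xy v by (simp_all add: a_ac)
        have "(v \<oplus> x) \<oplus> (v \<oplus> y) = v \<oplus> (v \<oplus> (x \<oplus> y))"
          using xy v by (simp add: a_ac)
        then show "(v \<oplus> x) \<oplus> (v \<oplus> y) = x \<oplus> y"
          using vv xy by simp
      qed
      then show ?thesis using that unfolding eq
        by (elim UnE imageE) (auto intro: E.a_closed)
    qed
  qed
qed

text \<open>Each step in a derivation of \<open>dimension\<close> adjoins a vector outside the
  previous space and so doubles its size.\<close>

lemma (in ring) card_eq_two_power_dimension:
  assumes "\<And>x. x \<in> carrier R \<Longrightarrow> x \<oplus> x = \<zero>" and "dimension n {\<zero>, \<one>} E"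
  shows "additive_subgroup E R \<and> finite E \<and> card E = 2 ^ n"
  using assms(2)
proof (induction n "{\<zero>, \<one>}" E rule: dimension.induct)
  case zero_dim
  show ?case
    by (auto intro!: additive_subgroupI add.subgroupI)
next
  case (Suc_dim v E n)
  then show ?case
    using line_extension_card_subgroup[OF assms(1)] by simp
qed

text \<open>Greedy extension: a subspace F of E that misses a vector of E can be enlarged inside E,
  and finiteness of E ends the process.\<close>

lemma (in ring) dimension_exists:
  assumes char2: "\<And>x. x \<in> carrier R \<Longrightarrow> x \<oplus> x = \<zero>"
    and E: "additive_subgroup E R" "finite E"
  shows "\<exists>n. dimension n {\<zero>, \<one>} E"
proof -
  interpret E: additive_subgroup E R by fact
  have "\<exists>m. dimension m {\<zero>, \<one>} E" if "dimension n {\<zero>, \<one>} F" "F \<subseteq> E" for n F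
    using that
  proof (induction "card E - card F" arbitrary: n F rule: less_induct)
    case less
    note F = card_eq_two_power_dimension[OF char2 less.prems(1)]
    show ?case
    proof (cases "F = E")
      case True
      then show ?thesis using less.prems by auto
    next
      case False
      then obtain v where v: "v \<in> E" "v \<notin> F" using less.prems by auto
      let ?G = "line_extension {\<zero>, \<one>} v F"
      have vc: "v \<in> carrier R" using v E.a_subset by auto
      have "?G = F \<union> (\<lambda>e. v \<oplus> e) ` F"
        by (rule line_extension_prime_field[OF vc]) (use less.prems E.a_subset in auto)
      then have sub: "?G \<subseteq> E" using v less.prems by auto
      \<comment> \<open>Doubling makes the measure drop strictly, because F is nonempty and the
        enlarged space still fits into E.\<close>
      have "card ?G = 2 * card F"
        using line_extension_card_subgroup(3)[OF char2 vc v(2)] F by simp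
      moreover have "card F > 0" using F by simp
      moreover have "card ?G \<le> card E" using sub E by (simp add: card_mono)
      ultimately have "card E - card ?G < card E - card F" by simp
      then show ?thesis
        using less.hyps Suc_dim[OF vc v(2) less.prems(1)] sub by blast
    qed
  qed
  from this[OF zero_dim] show ?thesis by simp
qed

text \<open>Also true in the zero ring, where the scalars do not form a field.\<close>

lemma card_eq_two_power_dim_Z2:
  assumes "ring A" and char2: "\<And>x. x \<in> carrier A \<Longrightarrow> x \<oplus>\<^bsub>A\<^esub> x = \<zero>\<^bsub>A\<^esub>"
    and E: "additive_subgroup E A" "finite E"
  shows "card E = 2 ^ dim_Z2 A E"
proof -
  interpret ring A by fact
  obtain n where n: "dimension n {\<zero>\<^bsub>A\<^esub>, \<one>\<^bsub>A\<^esub>} E"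
    using dimension_exists[OF char2 E] by auto
  \<comment> \<open>The exponent can be read off the cardinality, so the dimension is unique and
    \<open>dim\<close> returns it.\<close>
  have "m = n" if "dimension m {\<zero>\<^bsub>A\<^esub>, \<one>\<^bsub>A\<^esub>} E" for m
    using card_eq_two_power_dimension[OF char2 n] card_eq_two_power_dimension[OF char2 that]
    by simp
  then have "dim_Z2 A E = n"
    unfolding dim_Z2_def dim_def using n by blast
  then show ?thesis using card_eq_two_power_dimension[OF char2 n] by simp
qed

section \<open>Counting in finite abelian groups\<close>

text \<open>First isomorphism theorem in counted form. Only the fibres of h matter, so h may be a
  plain function: it is used both for multiplication into the square of S and for the natural map
  from S to S / I.\<close>

lemma card_image_times_card_subgroup:
  assumes "abelian_group G" "additive_subgroup N G" "finite (carrier G)"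
    and h: "\<And>x y. x \<in> carrier G \<Longrightarrow> y \<in> carrier G \<Longrightarrow> h x = h y \<longleftrightarrow> x \<ominus>\<^bsub>G\<^esub> y \<in> N"
  shows "card (h ` carrier G) * card N = card (carrier G)"
proof -
  interpret abelian_group G by fact
  interpret N: abelian_subgroup N G
    using assms(1,2) by (rule abelian_subgroupI3[rotated])
  have coset_eq: "N +>\<^bsub>G\<^esub> x = N +>\<^bsub>G\<^esub> y \<longleftrightarrow> h x = h y"
    if "x \<in> carrier G" "y \<in> carrier G" for x y
  proof -
    have "N +>\<^bsub>G\<^esub> x = N +>\<^bsub>G\<^esub> y \<longleftrightarrow> x \<in> N +>\<^bsub>G\<^esub> y"
      using N.a_repr_independence'[OF _ that(2)] N.a_rcos_self[OF that(1)] by auto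
    also have "\<dots> \<longleftrightarrow> x \<ominus>\<^bsub>G\<^esub> y \<in> N"
      using that N.a_rcos_module[of y x] by (simp add: a_minus_def)
    finally show ?thesis using h that by simp
  qed
  have rc: "a_rcosets\<^bsub>G\<^esub> N = (\<lambda>x. N +>\<^bsub>G\<^esub> x) ` carrier G"
    by (auto simp: A_RCOSETS_def')
  have "card (a_rcosets\<^bsub>G\<^esub> N) = card (h ` carrier G)"
  proof (rule bij_betw_same_card)
    \<comment> \<open>By \<open>coset_eq\<close> the value of h does not depend on the chosen
      representative, and different cosets get different values.\<close>
    show "bij_betw (\<lambda>c. h (SOME x. x \<in> carrier G \<and> c = N +>\<^bsub>G\<^esub> x)) (a_rcosets\<^bsub>G\<^esub> N) (h ` carrier G)"
    proof -
      have "h (SOME z. z \<in> carrier G \<and> N +>\<^bsub>G\<^esub> x = N +>\<^bsub>G\<^esub> z) = h x" if "x \<in> carrier G" for x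
        using someI[of "\<lambda>z. z \<in> carrier G \<and> N +>\<^bsub>G\<^esub> x = N +>\<^bsub>G\<^esub> z" x] that coset_eq by auto
      then show ?thesis
        unfolding rc bij_betw_def inj_on_def using coset_eq by (auto simp: image_image)
    qed
  qed
  moreover have "card (a_rcosets\<^bsub>G\<^esub> N) * card N = card (carrier G)"
    using a_lagrange[OF assms(3)] assms(2) by (simp add: Coset.order_def)
  ultimately show ?thesis by simp
qed

text \<open>The nontrivial additive character of the two-element field, with integer values so that
  character sums count elements.\<close>

definition sign_of_bit :: "bit \<Rightarrow> int"
  where "sign_of_bit b = (if b = 0 then 1 else - 1)"

lemma sign_of_bit_simps [simp]: "sign_of_bit 0 = 1" "sign_of_bit 1 = - 1"
  by (simp_all add: sign_of_bit_def)

text \<open>Orthogonality of characters: if \<phi> takes the value 1 at some h, translation by h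
  permutes H and flips every sign, so the sum equals its own negative.\<close>

lemma sum_sign_of_bit:
  assumes "abelian_group G" "additive_subgroup H G" "finite H"
    and add: "\<And>x y. x \<in> H \<Longrightarrow> y \<in> H \<Longrightarrow> \<phi> (x \<oplus>\<^bsub>G\<^esub> y) = \<phi> x + \<phi> y"
  shows "(\<Sum>x\<in>H. sign_of_bit (\<phi> x)) = (if \<forall>x\<in>H. \<phi> x = 0 then int (card H) else 0)"
proof (cases "\<forall>x\<in>H. \<phi> x = 0")
  case True
  then show ?thesis by simp
next
  case False
  interpret abelian_group G by fact
  interpret H: additive_subgroup H G by fact
  from False obtain h where h: "h \<in> H" "\<phi> h = 1"
    using bit_not_zero_iff by auto
  have hc: "h \<in> carrier G" using h by simp
  have "(\<Sum>x\<in>H. sign_of_bit (\<phi> x)) = (\<Sum>x\<in>H. sign_of_bit (\<phi> (h \<oplus>\<^bsub>G\<^esub> x)))"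
  proof (rule sum.reindex_bij_witness[of _ "\<lambda>x. h \<oplus>\<^bsub>G\<^esub> x" "\<lambda>x. \<ominus>\<^bsub>G\<^esub> h \<oplus>\<^bsub>G\<^esub> x"])
    fix x assume x: "x \<in> H"
    then have xc: "x \<in> carrier G" by simp
    show "h \<oplus>\<^bsub>G\<^esub> (\<ominus>\<^bsub>G\<^esub> h \<oplus>\<^bsub>G\<^esub> x) = x" using xc hc by (simp add: r_neg2)
    show "\<ominus>\<^bsub>G\<^esub> h \<oplus>\<^bsub>G\<^esub> (h \<oplus>\<^bsub>G\<^esub> x) = x" using xc hc by (simp add: r_neg1)
    show "\<ominus>\<^bsub>G\<^esub> h \<oplus>\<^bsub>G\<^esub> x \<in> H" "h \<oplus>\<^bsub>G\<^esub> x \<in> H" using x h by auto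
    show "sign_of_bit (\<phi> (h \<oplus>\<^bsub>G\<^esub> (\<ominus>\<^bsub>G\<^esub> h \<oplus>\<^bsub>G\<^esub> x))) = sign_of_bit (\<phi> x)"
      using xc hc by (simp add: r_neg2)
  qed
  also have "\<dots> = (\<Sum>x\<in>H. - sign_of_bit (\<phi> x))"
    by (rule sum.cong) (use h add in \<open>auto simp: sign_of_bit_def\<close>)
  finally show ?thesis using False by (auto simp: sum_negf)
qed

text \<open>
  The proof evaluates the sum of \<open>sign_of_bit (\<tau> (a \<otimes> b))\<close> over all a in I and all ring
  elements b in both orders.
\<close>

lemma (in cring) card_ideal_times_card_annihilator:
  assumes fin: "finite (carrier R)" and I: "ideal I R"
    and add: "\<And>x y. x \<in> carrier R \<Longrightarrow> y \<in> carrier R \<Longrightarrow> \<tau> (x \<oplus> y) = \<tau> x + \<tau> y"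
    and nondeg: "\<And>x. x \<in> carrier R \<Longrightarrow> (\<And>y. y \<in> carrier R \<Longrightarrow> \<tau> (x \<otimes> y) = (0 :: bit)) \<Longrightarrow> x = \<zero>"
  shows "card I * card {b \<in> carrier R. \<forall>a\<in>I. a \<otimes> b = \<zero>} = card (carrier R)"
proof -
  interpret I: ideal I R by fact
  have sub: "I \<subseteq> carrier R" by (rule I.a_subset)
  have finI: "finite I" using fin sub finite_subset by blast
  have agI: "additive_subgroup I R" by (rule I.is_additive_subgroup)
  have agR: "additive_subgroup (carrier R) R"
    by (rule additive_subgroupI) (rule add.subgroup_self)
  have \<tau>0: "\<tau> \<zero> = 0" using add[of \<zero> \<zero>] by simp
  \<comment> \<open>Here the orthogonal complement becomes the annihilator: for a in I the product a
    c is again in I, so \<tau> vanishes on (a c) b = (a b) c for every c, and nondegeneracy gives a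
    b = 0.\<close>
  have ann: "(\<forall>a\<in>I. \<tau> (a \<otimes> b) = 0) \<longleftrightarrow> (\<forall>a\<in>I. a \<otimes> b = \<zero>)" if b: "b \<in> carrier R" for b
  proof safe
    fix a assume H: "\<forall>a\<in>I. \<tau> (a \<otimes> b) = 0" and a: "a \<in> I"
    have ac: "a \<in> carrier R" using a sub by auto
    show "a \<otimes> b = \<zero>"
    proof (rule nondeg)
      show "a \<otimes> b \<in> carrier R" using ac b by simp
      fix c assume c: "c \<in> carrier R"
      have "(a \<otimes> b) \<otimes> c = (a \<otimes> c) \<otimes> b" using ac b c by (simp add: m_ac)
      then show "\<tau> ((a \<otimes> b) \<otimes> c) = 0" using H I.I_r_closed[OF a c] by simp
    qed
  qed (simp add: \<tau>0)
  have "(\<Sum>b\<in>carrier R. \<Sum>a\<in>I. sign_of_bit (\<tau> (a \<otimes> b)))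
      = (\<Sum>b\<in>carrier R. if \<forall>a\<in>I. a \<otimes> b = \<zero> then int (card I) else 0)"
  proof (rule sum.cong[OF refl])
    fix b assume b: "b \<in> carrier R"
    have "\<tau> ((x \<oplus> y) \<otimes> b) = \<tau> (x \<otimes> b) + \<tau> (y \<otimes> b)" if "x \<in> I" "y \<in> I" for x y
    proof -
      have "x \<in> carrier R" "y \<in> carrier R" using that sub by auto
      then show ?thesis using b add[of "x \<otimes> b" "y \<otimes> b"] by (simp add: l_distr)
    qed
    from sum_sign_of_bit[OF abelian_group_axioms agI finI, where \<phi> = "\<lambda>a. \<tau> (a \<otimes> b)", OF this]
    show "(\<Sum>a\<in>I. sign_of_bit (\<tau> (a \<otimes> b))) = (if \<forall>a\<in>I. a \<otimes> b = \<zero> then int (card I) else 0)"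
      using ann[OF b] by simp
  qed
  also have "\<dots> = int (card {b \<in> carrier R. \<forall>a\<in>I. a \<otimes> b = \<zero>} * card I)"
    using fin by (simp add: sum.If_cases Int_def conj_commute)
  finally have 1: "(\<Sum>b\<in>carrier R. \<Sum>a\<in>I. sign_of_bit (\<tau> (a \<otimes> b))) = \<dots>" .
  \<comment> \<open>In this order the inner sum runs over the whole ring, so nondegeneracy leaves
    only the term a = 0.\<close>
  have "(\<Sum>a\<in>I. \<Sum>b\<in>carrier R. sign_of_bit (\<tau> (a \<otimes> b)))
      = (\<Sum>a\<in>I. if a = \<zero> then int (card (carrier R)) else 0)"
  proof (rule sum.cong[OF refl])
    fix a assume "a \<in> I"
    then have a: "a \<in> carrier R" using sub by auto
    have "\<tau> (a \<otimes> (x \<oplus> y)) = \<tau> (a \<otimes> x) + \<tau> (a \<otimes> y)" if "x \<in> carrier R" "y \<in> carrier R" for x y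
      using that a add[of "a \<otimes> x" "a \<otimes> y"] by (simp add: r_distr)
    then have sum: "(\<Sum>b\<in>carrier R. sign_of_bit (\<tau> (a \<otimes> b)))
        = (if \<forall>b\<in>carrier R. \<tau> (a \<otimes> b) = 0 then int (card (carrier R)) else 0)"
      by (rule sum_sign_of_bit[OF abelian_group_axioms agR fin])
    show "(\<Sum>b\<in>carrier R. sign_of_bit (\<tau> (a \<otimes> b))) = (if a = \<zero> then int (card (carrier R)) else 0)"
    proof (cases "a = \<zero>")
      case True
      then show ?thesis using \<tau>0 by simp
    next
      case False
      then have "\<not> (\<forall>b\<in>carrier R. \<tau> (a \<otimes> b) = 0)" using nondeg[OF a] by blast
      then show ?thesis using False sum by (simp only: if_False)
    qed
  qed
  also have "\<dots> = int (card (carrier R))"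
    using finI by simp
  finally have "int (card {b \<in> carrier R. \<forall>a\<in>I. a \<otimes> b = \<zero>} * card I) = int (card (carrier R))"
    unfolding 1[symmetric] by (subst sum.swap)
  then show ?thesis by (simp only: of_nat_eq_iff mult.commute)
qed

section \<open>Ideals of the Laurent ring\<close>

lemma ring_of_type_algebra_simps [simp]:
  "carrier ring_of_type_algebra = UNIV"
  "x \<otimes>\<^bsub>ring_of_type_algebra\<^esub> y = x * y"
  "x \<oplus>\<^bsub>ring_of_type_algebra\<^esub> y = x + y"
  "\<zero>\<^bsub>ring_of_type_algebra\<^esub> = 0"
  "\<one>\<^bsub>ring_of_type_algebra\<^esub> = 1"
  by (simp_all add: ring_of_type_algebra_def)

lemma a_inv_ring_of_type_algebra [simp]:
  "\<ominus>\<^bsub>ring_of_type_algebra\<^esub> (x :: 'a :: comm_ring_1) = - x"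
proof -
  interpret ring "ring_of_type_algebra :: 'a ring" by (rule ring_from_type_algebra)
  show ?thesis using minus_equality[of "- x" x] by simp
qed

lemma a_minus_ring_of_type_algebra [simp]:
  "x \<ominus>\<^bsub>ring_of_type_algebra\<^esub> y = (x :: 'a :: comm_ring_1) - y"
  by (simp add: a_minus_def)

lemma ideal_ring_of_type_algebraI:
  fixes I :: "'a :: comm_ring_1 set"
  assumes "0 \<in> I" "\<And>a b. a \<in> I \<Longrightarrow> b \<in> I \<Longrightarrow> a + b \<in> I" "\<And>a x. a \<in> I \<Longrightarrow> x * a \<in> I"
  shows "ideal I ring_of_type_algebra"
proof -
  interpret ring "ring_of_type_algebra :: 'a ring" by (rule ring_from_type_algebra)
  have uminus: "- a \<in> I" if "a \<in> I" for a
    using assms(3)[OF that, of "- 1"] by simp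
  show ?thesis
  proof (rule idealI)
    show "subgroup I (add_monoid (ring_of_type_algebra :: 'a ring))"
      using assms(1,2) uminus
      by (intro add.subgroupI) auto
  qed (use assms(3) ring_axioms in \<open>auto simp: mult.commute\<close>)
qed

lemma ideal_ring_of_type_algebraD:
  fixes I :: "'a :: comm_ring_1 set"
  assumes "ideal I ring_of_type_algebra"
  shows "0 \<in> I" "\<And>a b. a \<in> I \<Longrightarrow> b \<in> I \<Longrightarrow> a + b \<in> I" "\<And>a x. a \<in> I \<Longrightarrow> x * a \<in> I"
    "\<And>a. a \<in> I \<Longrightarrow> - a \<in> I" "\<And>a b. a \<in> I \<Longrightarrow> b \<in> I \<Longrightarrow> a - b \<in> I"
proof -
  interpret ideal I "ring_of_type_algebra :: 'a ring" by fact
  show "0 \<in> I"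
    using additive_subgroup.zero_closed[OF is_additive_subgroup] unfolding ring_of_type_algebra_simps .
  show a: "a + b \<in> I" if "a \<in> I" "b \<in> I" for a b
    using additive_subgroup.a_closed[OF is_additive_subgroup that] by simp
  show m: "x * a \<in> I" if "a \<in> I" for a x using I_l_closed[OF that, of x] by simp
  show u: "- a \<in> I" if "a \<in> I" for a using m[OF that, of "- 1"] by simp
  show "a - b \<in> I" if "a \<in> I" "b \<in> I" for a b using a[OF that(1) u[OF that(2)]] by simp
qed

lemma coset_eq_iff:
  fixes I :: "'a :: comm_ring_1 set"
  assumes "ideal I ring_of_type_algebra"
  shows "I +>\<^bsub>ring_of_type_algebra\<^esub> p = I +>\<^bsub>ring_of_type_algebra\<^esub> q \<longleftrightarrow> p - q \<in> I"
proof -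
  interpret ideal I "ring_of_type_algebra :: 'a ring" by fact
  have "I +>\<^bsub>ring_of_type_algebra\<^esub> p = I +>\<^bsub>ring_of_type_algebra\<^esub> q \<longleftrightarrow> p \<in> I +>\<^bsub>ring_of_type_algebra\<^esub> q"
    using a_repr_independence'[of p q] a_rcos_self[of p] by auto
  also have "\<dots> \<longleftrightarrow> p - q \<in> I"
    using a_rcos_module[of q p] by simp
  finally show ?thesis .
qed

section \<open>Quotients of the Laurent ring\<close>

abbreviation laurent_ideal :: "laurent set \<Rightarrow> laurent set"
  where "laurent_ideal A \<equiv> Idl\<^bsub>laurent_ring\<^esub> A"

lemma ideal_Idl: "ideal (laurent_ideal A) laurent_ring"
  by (rule ring.genideal_ideal[OF ring_from_type_algebra]) simp

lemma Idl_superset: "A \<subseteq> laurent_ideal A"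
  by (rule ring.genideal_self[OF ring_from_type_algebra]) simp

lemma Idl_least: "ideal I laurent_ring \<Longrightarrow> A \<subseteq> I \<Longrightarrow> laurent_ideal A \<subseteq> I"
  by (rule ring.genideal_minimal[OF ring_from_type_algebra])

lemma laurent_double: "p + p = (0 :: laurent)"
proof (rule poly_mapping_eqI)
  fix v
  have "Poly_Mapping.lookup (p + p) v = Poly_Mapping.lookup p v + Poly_Mapping.lookup p v"
    by (rule lookup_add)
  then show "Poly_Mapping.lookup (p + p) v = Poly_Mapping.lookup 0 v"
    by (cases "Poly_Mapping.lookup p v") simp_all
qed

lemma laurent_uminus: "- p = (p :: laurent)"
  using laurent_double[of p] by (simp add: eq_neg_iff_add_eq_0[symmetric])

lemma laurent_minus: "p - q = p + (q :: laurent)"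
  by (simp only: diff_conv_add_uminus laurent_uminus)

lemma cring_laurent_quot: "cring (laurent_quot A)"
  unfolding laurent_quot_def
  by (rule ideal.quotient_is_cring[OF ideal_Idl cring_from_type_algebra])

lemma ring_laurent_quot: "ring (laurent_quot A)"
  by (rule cring.axioms(1)[OF cring_laurent_quot])

text \<open>\<open>torus_proj\<close> for arbitrary relations, so that the torus ring and its
  further quotient by f and g share the same lemmas.\<close>

definition quot_proj :: "laurent set \<Rightarrow> laurent \<Rightarrow> laurent set"
  where "quot_proj A p = laurent_ideal A +>\<^bsub>laurent_ring\<^esub> p"

lemma quot_proj_hom: "quot_proj A \<in> ring_hom laurent_ring (laurent_quot A)"
  using ideal.rcos_ring_hom[OF ideal_Idl[of A]]
  by (simp add: laurent_quot_def quot_proj_def[abs_def])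

lemma quot_proj_add: "quot_proj A (p + q) = quot_proj A p \<oplus>\<^bsub>laurent_quot A\<^esub> quot_proj A q"
  using ring_hom_add[OF quot_proj_hom, of p q A] by simp

lemma quot_proj_mult: "quot_proj A (p * q) = quot_proj A p \<otimes>\<^bsub>laurent_quot A\<^esub> quot_proj A q"
  using ring_hom_mult[OF quot_proj_hom, of p q A] by simp

lemma quot_proj_zero: "quot_proj A 0 = \<zero>\<^bsub>laurent_quot A\<^esub>"
  using ring_hom_zero[OF quot_proj_hom ring_from_type_algebra ring_laurent_quot, of A] by simp

lemma carrier_laurent_quot: "carrier (laurent_quot A) = range (quot_proj A)"
  by (auto simp: laurent_quot_def quot_proj_def FactRing_def A_RCOSETS_def')

lemma quot_proj_closed: "quot_proj A p \<in> carrier (laurent_quot A)"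
  by (simp add: carrier_laurent_quot)

lemma quot_proj_eq_iff: "quot_proj A p = quot_proj A q \<longleftrightarrow> p - q \<in> laurent_ideal A"
  unfolding quot_proj_def by (rule coset_eq_iff[OF ideal_Idl])

lemma quot_proj_eq_zero_iff: "quot_proj A p = \<zero>\<^bsub>laurent_quot A\<^esub> \<longleftrightarrow> p \<in> laurent_ideal A"
  using quot_proj_eq_iff[of A p 0] by (simp add: quot_proj_zero)

lemma laurent_quot_double:
  assumes "x \<in> carrier (laurent_quot A)"
  shows "x \<oplus>\<^bsub>laurent_quot A\<^esub> x = \<zero>\<^bsub>laurent_quot A\<^esub>"
  using assms unfolding carrier_laurent_quot
  by (auto simp flip: quot_proj_add quot_proj_zero simp: laurent_double)

lemma a_minus_quot_proj:
  "quot_proj A p \<ominus>\<^bsub>laurent_quot A\<^esub> quot_proj A q = quot_proj A (p - q)"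
proof -
  interpret cring "laurent_quot A" by (rule cring_laurent_quot)
  have "\<ominus>\<^bsub>laurent_quot A\<^esub> quot_proj A q = quot_proj A q"
    using minus_equality laurent_quot_double quot_proj_closed by blast
  then show ?thesis by (simp add: a_minus_def laurent_minus quot_proj_add)
qed

section \<open>Induction over monomials and the antipode\<close>

lemma laurent_induct [case_names zero add]:
  assumes "P 0" and "\<And>v p. P p \<Longrightarrow> P (Poly_Mapping.single v 1 + p)"
  shows "P (p :: laurent)"
proof (induction p rule: update_induct)
  case const
  show ?case by fact
next
  case (update p v b)
  \<comment> \<open>The exponent v is new and b, being nonzero, is 1; hence the update is the
    addition of a monomial.\<close>
  have "Poly_Mapping.update v b p = Poly_Mapping.single v 1 + p"
    using update(1,2)
    by (intro poly_mapping_eqI) (auto simp: lookup_update lookup_add lookup_single in_keys_iff)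
  then show ?case using assms(2)[OF update(3)] by simp
qed

lemma antipode_single: "antipode (Poly_Mapping.single v c) = Poly_Mapping.single (- v) c"
  using map_key_single[of "uminus :: int \<times> int \<Rightarrow> _" "- v" c] by (simp add: antipode_def)

text \<open>Both sides are additive in p and in q, so two nested inductions reduce the claim to
  monomials, where it says that negation of exponents is additive.\<close>

lemma antipode_mult: "antipode (p * q) = antipode p * antipode q"
proof (induction p rule: laurent_induct)
  case zero
  then show ?case by (simp add: antipode_zero)
next
  case (add v p)
  have "antipode (Poly_Mapping.single v 1 * q) = antipode (Poly_Mapping.single v 1) * antipode q"
    by (induction q rule: laurent_induct)
      (simp_all add: antipode_zero antipode_add antipode_single ring_distribs mult_single)
  with add show ?case by (simp add: antipode_add ring_distribs)
qed

lemma antipode_antipode: "antipode (antipode p) = p"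
  by (induction p rule: laurent_induct) (simp_all add: antipode_zero antipode_add antipode_single)

lemma antipode_diff: "antipode (p - q) = antipode p - antipode q"
  by (simp add: laurent_minus antipode_add)

section \<open>The torus\<close>

definition torus_lattice :: "int \<Rightarrow> int \<Rightarrow> int \<Rightarrow> (int \<times> int) set"
  where "torus_lattice \<alpha> \<beta> \<gamma> = {(a * \<beta>, a * \<gamma> + b * \<alpha>) | a b. True}"

text \<open>A fundamental domain of the lattice. The twist \<gamma> does not enter: once a multiple
  of (\<beta>, \<gamma>) has fixed the column, only multiples of \<alpha> act within it.\<close>

definition torus_cells :: "int \<Rightarrow> int \<Rightarrow> (int \<times> int) set"
  where "torus_cells \<alpha> \<beta> = {0..<\<beta>} \<times> {0..<\<alpha>}"

lemma finite_torus_cells: "finite (torus_cells \<alpha> \<beta>)"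
  by (simp add: torus_cells_def)

lemma card_torus_cells: "\<alpha> \<ge> 1 \<Longrightarrow> \<beta> \<ge> 1 \<Longrightarrow> int (card (torus_cells \<alpha> \<beta>)) = \<alpha> * \<beta>"
  by (simp add: torus_cells_def)

lemma torus_lattice_add:
  assumes "u \<in> torus_lattice \<alpha> \<beta> \<gamma>" "v \<in> torus_lattice \<alpha> \<beta> \<gamma>"
  shows "u + v \<in> torus_lattice \<alpha> \<beta> \<gamma>"
proof -
  obtain a b c d where "u = (a * \<beta>, a * \<gamma> + b * \<alpha>)" "v = (c * \<beta>, c * \<gamma> + d * \<alpha>)"
    using assms by (auto simp: torus_lattice_def)
  then have "u + v = ((a + c) * \<beta>, (a + c) * \<gamma> + (b + d) * \<alpha>)"
    by (simp add: algebra_simps)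
  then show ?thesis unfolding torus_lattice_def by blast
qed

lemma torus_lattice_uminus:
  assumes "u \<in> torus_lattice \<alpha> \<beta> \<gamma>"
  shows "- u \<in> torus_lattice \<alpha> \<beta> \<gamma>"
proof -
  obtain a b where "u = (a * \<beta>, a * \<gamma> + b * \<alpha>)"
    using assms by (auto simp: torus_lattice_def)
  then have "- u = ((- a) * \<beta>, (- a) * \<gamma> + (- b) * \<alpha>)"
    by (simp add: algebra_simps)
  then show ?thesis unfolding torus_lattice_def by blast
qed

lemma torus_lattice_generators:
  "(0, \<alpha>) \<in> torus_lattice \<alpha> \<beta> \<gamma>" "(\<beta>, \<gamma>) \<in> torus_lattice \<alpha> \<beta> \<gamma>"
proof -
  have "(0, \<alpha>) = (0 * \<beta>, 0 * \<gamma> + 1 * \<alpha>)" "(\<beta>, \<gamma>) = (1 * \<beta>, 1 * \<gamma> + 0 * \<alpha>)" by simp_all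
  then show "(0, \<alpha>) \<in> torus_lattice \<alpha> \<beta> \<gamma>" "(\<beta>, \<gamma>) \<in> torus_lattice \<alpha> \<beta> \<gamma>"
    unfolding torus_lattice_def by blast+
qed

lemma torus_lattice_add_iff:
  assumes "u \<in> torus_lattice \<alpha> \<beta> \<gamma>"
  shows "u + v \<in> torus_lattice \<alpha> \<beta> \<gamma> \<longleftrightarrow> v \<in> torus_lattice \<alpha> \<beta> \<gamma>"
  using torus_lattice_add[OF assms, of v]
    torus_lattice_add[OF torus_lattice_uminus[OF assms], of "u + v"] by auto

lemma torus_cells_representative:
  assumes "\<alpha> \<ge> 1" "\<beta> \<ge> 1"
  shows "\<exists>d\<in>torus_cells \<alpha> \<beta>. v - d \<in> torus_lattice \<alpha> \<beta> \<gamma>"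
proof -
  obtain n m where v: "v = (n, m)" by (cases v)
  \<comment> \<open>Bringing the first coordinate into range uses a copies of (\<beta>, \<gamma>),
    which shifts the second coordinate by a \<gamma> before it is reduced modulo \<alpha>.\<close>
  define a where "a = n div \<beta>"
  define d where "d = (n mod \<beta>, (m - a * \<gamma>) mod \<alpha>)"
  have "v - d = (a * \<beta>, a * \<gamma> + ((m - a * \<gamma>) div \<alpha>) * \<alpha>)"
    using div_mult_mod_eq[of n \<beta>] div_mult_mod_eq[of "m - a * \<gamma>" \<alpha>]
    by (simp add: v d_def a_def algebra_simps)
  then have "v - d \<in> torus_lattice \<alpha> \<beta> \<gamma>" unfolding torus_lattice_def by blast
  moreover have "d \<in> torus_cells \<alpha> \<beta>" using assms by (simp add: d_def torus_cells_def)
  ultimately show ?thesis by blast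
qed

lemma torus_cells_unique:
  assumes "d \<in> torus_cells \<alpha> \<beta>" "e \<in> torus_cells \<alpha> \<beta>" "e - d \<in> torus_lattice \<alpha> \<beta> \<gamma>"
  shows "d = e"
proof -
  obtain n m n' m' where de: "d = (n, m)" "e = (n', m')" by (cases d, cases e)
  obtain a b where ab: "n' - n = a * \<beta>" "m' - m = a * \<gamma> + b * \<alpha>"
    using assms(3) by (auto simp: de torus_lattice_def)
  \<comment> \<open>Two cells differ by less than a side of the box in each coordinate. The first
    coordinate forces a = 0, and only then is the second a pure multiple of \<alpha>.\<close>
  have small: "k = 0" if "\<bar>k * z\<bar> < z" for k z :: int
  proof (rule ccontr)
    assume "k \<noteq> 0"
    then have "1 * \<bar>z\<bar> \<le> \<bar>k\<bar> * \<bar>z\<bar>" by (intro mult_right_mono) auto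
    then show False using that by (simp only: abs_mult)
  qed
  have "\<bar>a * \<beta>\<bar> < \<beta>" using assms(1,2) ab(1) by (auto simp: de torus_cells_def)
  then have a: "a = 0" by (rule small)
  then have "\<bar>b * \<alpha>\<bar> < \<alpha>" using assms(1,2) ab(2) by (auto simp: de torus_cells_def)
  then have "b = 0" by (rule small)
  with a ab show ?thesis by (simp add: de)
qed

section \<open>The constant-coefficient form and its radical\<close>

text \<open>The constant coefficient of the image of p in the torus ring.\<close>

definition torus_coeff :: "int \<Rightarrow> int \<Rightarrow> int \<Rightarrow> laurent \<Rightarrow> bit"
  where "torus_coeff \<alpha> \<beta> \<gamma> p =
    (\<Sum>v\<in>Poly_Mapping.keys p. if v \<in> torus_lattice \<alpha> \<beta> \<gamma> then Poly_Mapping.lookup p v else 0)"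

lemma torus_coeff_add: "torus_coeff \<alpha> \<beta> \<gamma> (p + q) = torus_coeff \<alpha> \<beta> \<gamma> p + torus_coeff \<alpha> \<beta> \<gamma> q"
  unfolding torus_coeff_def
  by (rule setsum_keys_plus_distrib[where f = "\<lambda>v c. if v \<in> torus_lattice \<alpha> \<beta> \<gamma> then c else 0"]) auto

lemma torus_coeff_zero: "torus_coeff \<alpha> \<beta> \<gamma> 0 = 0"
  by (simp add: torus_coeff_def)

lemma torus_coeff_single:
  "torus_coeff \<alpha> \<beta> \<gamma> (Poly_Mapping.single v 1) = (if v \<in> torus_lattice \<alpha> \<beta> \<gamma> then 1 else 0)"
  by (simp add: torus_coeff_def)

lemma torus_coeff_sum: "torus_coeff \<alpha> \<beta> \<gamma> (\<Sum>d\<in>A. h d) = (\<Sum>d\<in>A. torus_coeff \<alpha> \<beta> \<gamma> (h d))"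
  by (induction A rule: infinite_finite_induct) (simp_all add: torus_coeff_zero torus_coeff_add)

text \<open>The radical of the form sending p, q to \<open>torus_coeff\<close> of their product.
  Letting q range over all multipliers makes it an ideal, with a membership test that can be
  computed.\<close>

definition torus_kernel :: "int \<Rightarrow> int \<Rightarrow> int \<Rightarrow> laurent set"
  where "torus_kernel \<alpha> \<beta> \<gamma> = {p. \<forall>q. torus_coeff \<alpha> \<beta> \<gamma> (q * p) = 0}"

lemma ideal_torus_kernel: "ideal (torus_kernel \<alpha> \<beta> \<gamma>) laurent_ring"
  by (rule ideal_ring_of_type_algebraI)
    (auto simp: torus_kernel_def torus_coeff_zero torus_coeff_add distrib_left simp flip: mult.assoc)

abbreviation torus_ideal :: "int \<Rightarrow> int \<Rightarrow> int \<Rightarrow> laurent set"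
  where "torus_ideal \<alpha> \<beta> \<gamma> \<equiv> laurent_ideal (torus_relations \<alpha> \<beta> \<gamma>)"

text \<open>Translation by a lattice vector u preserves membership in the lattice, so the two terms
  of x^v (x^u - 1) contribute equal bits, which cancel.\<close>

lemma torus_ideal_subset_kernel: "torus_ideal \<alpha> \<beta> \<gamma> \<subseteq> torus_kernel \<alpha> \<beta> \<gamma>"
proof (rule Idl_least[OF ideal_torus_kernel])
  have "torus_coeff \<alpha> \<beta> \<gamma> (q * (Poly_Mapping.single u 1 - 1)) = 0"
    if "u \<in> torus_lattice \<alpha> \<beta> \<gamma>" for u q
  proof (induction q rule: laurent_induct)
    case (add v q)
    have "Poly_Mapping.single v 1 * (Poly_Mapping.single u 1 - 1)
        = Poly_Mapping.single (u + v) 1 + Poly_Mapping.single v (1 :: bit)"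
      by (simp add: laurent_minus distrib_left mult_single add.commute)
    then have "torus_coeff \<alpha> \<beta> \<gamma> (Poly_Mapping.single v 1 * (Poly_Mapping.single u 1 - 1)) = 0"
      by (simp add: torus_coeff_add torus_coeff_single torus_lattice_add_iff[OF that])
    with add show ?case by (simp add: distrib_right torus_coeff_add)
  qed (simp add: torus_coeff_zero)
  then show "torus_relations \<alpha> \<beta> \<gamma> \<subseteq> torus_kernel \<alpha> \<beta> \<gamma>"
    using torus_lattice_generators
    by (auto simp: torus_relations_def torus_kernel_def monomial_def)
qed

text \<open>The exponents u with x^u - 1 in the ideal form a group containing both generators of the
  lattice: x^(u+v) - 1 = x^u (x^v - 1) + (x^u - 1), and x^(-u) - 1 is a multiple of x^u - 1 because
  monomials are units.\<close>

lemma single_minus_one_in_torus_ideal: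
  assumes "u \<in> torus_lattice \<alpha> \<beta> \<gamma>"
  shows "Poly_Mapping.single u 1 - 1 \<in> torus_ideal \<alpha> \<beta> \<gamma>"
proof -
  let ?H = "{u. Poly_Mapping.single u 1 - (1 :: laurent) \<in> torus_ideal \<alpha> \<beta> \<gamma>}"
  note J = ideal_ring_of_type_algebraD[OF ideal_Idl[of "torus_relations \<alpha> \<beta> \<gamma>"]]
  have zero: "0 \<in> ?H" using J(1) by simp
  have add: "u + v \<in> ?H" if "u \<in> ?H" "v \<in> ?H" for u v
  proof -
    have "Poly_Mapping.single (u + v) 1 - (1 :: laurent)
        = Poly_Mapping.single u 1 * (Poly_Mapping.single v 1 - 1) + (Poly_Mapping.single u 1 - 1)"
      by (simp add: right_diff_distrib mult_single)
    moreover have "Poly_Mapping.single u 1 * (Poly_Mapping.single v 1 - 1)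
        + (Poly_Mapping.single u 1 - 1) \<in> torus_ideal \<alpha> \<beta> \<gamma>"
      using J(2,3) that by blast
    ultimately show ?thesis by (simp only: mem_Collect_eq)
  qed
  have uminus: "- u \<in> ?H" if "u \<in> ?H" for u
  proof -
    have "Poly_Mapping.single (- u) 1 - (1 :: laurent)
        = - (Poly_Mapping.single (- u) 1 * (Poly_Mapping.single u 1 - 1))"
      by (simp add: right_diff_distrib mult_single)
    then show ?thesis using J(3,4) that by simp
  qed
  have times_nat: "(int k * n, int k * m) \<in> ?H" if "(n, m) \<in> ?H" for k n m
  proof (induction k)
    case 0
    then show ?case using zero by (simp add: zero_prod_def)
  next
    case (Suc k)
    from add[OF that this] show ?case by (simp add: algebra_simps)
  qed
  have times: "(k * n, k * m) \<in> ?H" if "(n, m) \<in> ?H" for k n m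
  proof (cases "k \<ge> 0")
    case True
    then show ?thesis using times_nat[OF that, of "nat k"] by simp
  next
    case False
    then show ?thesis using uminus[OF times_nat[OF that, of "nat (- k)"]] by simp
  qed
  have gens: "(0, \<alpha>) \<in> ?H" "(\<beta>, \<gamma>) \<in> ?H"
    using Idl_superset[of "torus_relations \<alpha> \<beta> \<gamma>"] by (auto simp: torus_relations_def monomial_def)
  obtain a b where u: "u = (a * \<beta>, a * \<gamma> + b * \<alpha>)"
    using assms by (auto simp: torus_lattice_def)
  have "u \<in> ?H"
    using add[OF times[OF gens(2), of a] times[OF gens(1), of b]] by (simp add: u)
  then show ?thesis by simp
qed

text \<open>Over the two-element field a polynomial is determined by its support, so sets of cells
  serve as normal forms and addition becomes symmetric difference.\<close>

definition cell_sum :: "(int \<times> int) set \<Rightarrow> laurent"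
  where "cell_sum A = (\<Sum>d\<in>A. Poly_Mapping.single d 1)"

lemma cell_sum_add:
  assumes "finite A" "finite B"
  shows "cell_sum A + cell_sum B = cell_sum (sym_diff A B)"
proof -
  have "cell_sum A = cell_sum (A - B) + cell_sum (A \<inter> B)"
       "cell_sum B = cell_sum (B - A) + cell_sum (A \<inter> B)"
    unfolding cell_sum_def
    using sum.Int_Diff[OF assms(1), of "\<lambda>d. Poly_Mapping.single d 1" B]
      sum.Int_Diff[OF assms(2), of "\<lambda>d. Poly_Mapping.single d 1" A]
    by (simp_all only: add.commute Int_commute)
  moreover have "cell_sum (sym_diff A B) = cell_sum (A - B) + cell_sum (B - A)"
    using assms unfolding cell_sum_def by (intro sum.union_disjoint) auto
  ultimately have "cell_sum A + cell_sum B
      = cell_sum (sym_diff A B) + (cell_sum (A \<inter> B) + cell_sum (A \<inter> B))"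
    by (simp only: ac_simps)
  then show ?thesis by (simp add: laurent_double)
qed

lemma reduce_to_cells:
  assumes "\<alpha> \<ge> 1" "\<beta> \<ge> 1"
  shows "\<exists>A \<subseteq> torus_cells \<alpha> \<beta>. p - cell_sum A \<in> torus_ideal \<alpha> \<beta> \<gamma>"
proof (induction p rule: laurent_induct)
  case zero
  show ?case
    using ideal_ring_of_type_algebraD(1)[OF ideal_Idl] by (auto simp: cell_sum_def intro!: exI[of _ "{}"])
next
  case (add v p)
  note J = ideal_ring_of_type_algebraD[OF ideal_Idl[of "torus_relations \<alpha> \<beta> \<gamma>"]]
  obtain A where A: "A \<subseteq> torus_cells \<alpha> \<beta>" "p - cell_sum A \<in> torus_ideal \<alpha> \<beta> \<gamma>"
    using add by blast
  obtain d where d: "d \<in> torus_cells \<alpha> \<beta>" "v - d \<in> torus_lattice \<alpha> \<beta> \<gamma>"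
    using torus_cells_representative[OF assms] by blast
  have "Poly_Mapping.single v 1 - Poly_Mapping.single d (1 :: bit)
      = Poly_Mapping.single d 1 * (Poly_Mapping.single (v - d) 1 - 1)"
    by (simp add: right_diff_distrib mult_single)
  then have v: "Poly_Mapping.single v 1 - Poly_Mapping.single d (1 :: bit) \<in> torus_ideal \<alpha> \<beta> \<gamma>"
    using J(3)[OF single_minus_one_in_torus_ideal[OF d(2)]] by simp
  have "finite A" using A(1) finite_torus_cells finite_subset by blast
  \<comment> \<open>The cell d may already belong to A, in which case the new monomial cancels it;
    hence it is toggled rather than inserted.\<close>
  then have "cell_sum (sym_diff {d} A) = Poly_Mapping.single d 1 + cell_sum A"
    by (subst cell_sum_add[symmetric]) (simp_all add: cell_sum_def)
  then have "Poly_Mapping.single v 1 + p - cell_sum (sym_diff {d} A)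
      = (Poly_Mapping.single v 1 - Poly_Mapping.single d 1) + (p - cell_sum A)"
    by (simp add: algebra_simps)
  then have "Poly_Mapping.single v 1 + p - cell_sum (sym_diff {d} A) \<in> torus_ideal \<alpha> \<beta> \<gamma>"
    using J(2)[OF v A(2)] by (simp only:)
  moreover have "sym_diff {d} A \<subseteq> torus_cells \<alpha> \<beta>" using A(1) d(1) by auto
  ultimately show ?case by blast
qed

text \<open>If d were in A, multiplication by x^(-d) would move its coefficient to the constant
  position. No other cell of A is congruent to d, so \<open>torus_coeff\<close> would give
  1.\<close>

lemma cell_sum_in_torus_kernelD:
  assumes A: "A \<subseteq> torus_cells \<alpha> \<beta>" and "cell_sum A \<in> torus_kernel \<alpha> \<beta> \<gamma>"
  shows "A = {}"
proof (rule ccontr)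
  assume "A \<noteq> {}"
  then obtain d where d: "d \<in> A" by auto
  have fin: "finite A" using A finite_torus_cells finite_subset by blast
  have eq: "Poly_Mapping.single (- d) 1 * cell_sum A = (\<Sum>e\<in>A. Poly_Mapping.single (e - d) 1)"
    by (simp add: cell_sum_def sum_distrib_left mult_single)
  have "e - d \<in> torus_lattice \<alpha> \<beta> \<gamma> \<longleftrightarrow> e = d" if "e \<in> A" for e
  proof
    assume "e - d \<in> torus_lattice \<alpha> \<beta> \<gamma>"
    then show "e = d" using torus_cells_unique[of d \<alpha> \<beta> e] A d that by auto
  next
    assume "e = d"
    then show "e - d \<in> torus_lattice \<alpha> \<beta> \<gamma>"
      by (auto simp: torus_lattice_def zero_prod_def intro!: exI[of _ 0])
  qed
  then have "torus_coeff \<alpha> \<beta> \<gamma> (Poly_Mapping.single (- d) 1 * cell_sum A) = (\<Sum>e\<in>A. if e = d then 1 else 0)"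
    unfolding eq torus_coeff_sum by (intro sum.cong) (simp_all add: torus_coeff_single)
  also have "\<dots> = 1" using fin d by simp
  finally show False using assms(2) by (simp add: torus_kernel_def)
qed

text \<open>Modulo the ideal every p is a sum of cells, and the radical contains only the empty sum.
  This is nondegeneracy of the form induced on the torus ring.\<close>

lemma torus_kernel_eq_ideal:
  assumes "\<alpha> \<ge> 1" "\<beta> \<ge> 1"
  shows "torus_kernel \<alpha> \<beta> \<gamma> = torus_ideal \<alpha> \<beta> \<gamma>"
proof
  show "torus_kernel \<alpha> \<beta> \<gamma> \<subseteq> torus_ideal \<alpha> \<beta> \<gamma>"
  proof
    fix p assume p: "p \<in> torus_kernel \<alpha> \<beta> \<gamma>"
    obtain A where A: "A \<subseteq> torus_cells \<alpha> \<beta>" "p - cell_sum A \<in> torus_ideal \<alpha> \<beta> \<gamma>"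
      using reduce_to_cells[OF assms] by blast
    then have "p - (p - cell_sum A) \<in> torus_kernel \<alpha> \<beta> \<gamma>"
      using p torus_ideal_subset_kernel ideal_ring_of_type_algebraD(5)[OF ideal_torus_kernel] by blast
    then have "A = {}" using cell_sum_in_torus_kernelD[OF A(1)] by simp
    then show "p \<in> torus_ideal \<alpha> \<beta> \<gamma>" using A by (simp add: cell_sum_def)
  qed
qed (rule torus_ideal_subset_kernel)

section \<open>Size of the torus ring and its nondegenerate form\<close>

lemma torus_proj_eq_quot_proj: "torus_proj \<alpha> \<beta> \<gamma> = quot_proj (torus_relations \<alpha> \<beta> \<gamma>)"
  by (simp add: torus_proj_def[abs_def] quot_proj_def[abs_def])

lemma card_carrier_torus:
  assumes "\<alpha> \<ge> 1" "\<beta> \<ge> 1"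
  shows "finite (carrier (torus \<alpha> \<beta> \<gamma>))" "card (carrier (torus \<alpha> \<beta> \<gamma>)) = 2 ^ nat (\<alpha> * \<beta>)"
proof -
  let ?\<pi> = "quot_proj (torus_relations \<alpha> \<beta> \<gamma>)"
  let ?h = "\<lambda>A. ?\<pi> (cell_sum A)"
  have "bij_betw ?h (Pow (torus_cells \<alpha> \<beta>)) (carrier (torus \<alpha> \<beta> \<gamma>))"
    unfolding bij_betw_def
  proof
    show "inj_on ?h (Pow (torus_cells \<alpha> \<beta>))"
    proof (rule inj_onI)
      fix A B assume AB: "A \<in> Pow (torus_cells \<alpha> \<beta>)" "B \<in> Pow (torus_cells \<alpha> \<beta>)" "?h A = ?h B"
      have fin: "finite A" "finite B" using AB finite_torus_cells finite_subset by blast+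
      \<comment> \<open>The difference of the two normal forms is itself a normal form and lies in
        the ideal, hence in the radical.\<close>
      have "cell_sum (sym_diff A B) \<in> torus_kernel \<alpha> \<beta> \<gamma>"
        using AB(3) cell_sum_add[OF fin] torus_ideal_subset_kernel
        unfolding quot_proj_eq_iff laurent_minus by auto
      moreover have "sym_diff A B \<subseteq> torus_cells \<alpha> \<beta>" using AB by auto
      ultimately have "sym_diff A B = {}" using cell_sum_in_torus_kernelD by blast
      then show "A = B" by auto
    qed
    show "?h ` Pow (torus_cells \<alpha> \<beta>) = carrier (torus \<alpha> \<beta> \<gamma>)"
    proof
      show "carrier (torus \<alpha> \<beta> \<gamma>) \<subseteq> ?h ` Pow (torus_cells \<alpha> \<beta>)"
      proof
        fix c assume "c \<in> carrier (torus \<alpha> \<beta> \<gamma>)"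
        then obtain p where c: "c = ?\<pi> p" by (auto simp: torus_def carrier_laurent_quot)
        obtain A where "A \<subseteq> torus_cells \<alpha> \<beta>" "p - cell_sum A \<in> torus_ideal \<alpha> \<beta> \<gamma>"
          using reduce_to_cells[OF assms] by blast
        then show "c \<in> ?h ` Pow (torus_cells \<alpha> \<beta>)" using c by (auto simp: quot_proj_eq_iff[symmetric])
      qed
    qed (auto simp: torus_def quot_proj_closed)
  qed
  then have "finite (carrier (torus \<alpha> \<beta> \<gamma>)) = finite (Pow (torus_cells \<alpha> \<beta>))"
    "card (carrier (torus \<alpha> \<beta> \<gamma>)) = card (Pow (torus_cells \<alpha> \<beta>))"
    using bij_betw_finite bij_betw_same_card by metis+
  moreover have "card (torus_cells \<alpha> \<beta>) = nat (\<alpha> * \<beta>)" using card_torus_cells[OF assms] by simp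
  ultimately show "finite (carrier (torus \<alpha> \<beta> \<gamma>))" "card (carrier (torus \<alpha> \<beta> \<gamma>)) = 2 ^ nat (\<alpha> * \<beta>)"
    using finite_torus_cells by (simp_all add: card_Pow)
qed

lemma torus_nondegenerate_functional:
  assumes "\<alpha> \<ge> 1" "\<beta> \<ge> 1"
  obtains \<tau> :: "laurent set \<Rightarrow> bit" where
    "\<And>x y. x \<in> carrier (torus \<alpha> \<beta> \<gamma>) \<Longrightarrow> y \<in> carrier (torus \<alpha> \<beta> \<gamma>)
      \<Longrightarrow> \<tau> (x \<oplus>\<^bsub>torus \<alpha> \<beta> \<gamma>\<^esub> y) = \<tau> x + \<tau> y"
    "\<And>x. x \<in> carrier (torus \<alpha> \<beta> \<gamma>) \<Longrightarrow>
      (\<And>y. y \<in> carrier (torus \<alpha> \<beta> \<gamma>) \<Longrightarrow> \<tau> (x \<otimes>\<^bsub>torus \<alpha> \<beta> \<gamma>\<^esub> y) = 0) \<Longrightarrow> x = \<zero>\<^bsub>torus \<alpha> \<beta> \<gamma>\<^esub>"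
proof
  let ?A = "torus_relations \<alpha> \<beta> \<gamma>"
  \<comment> \<open>The choice of representative is harmless: two of them differ by an element of
    the radical, which \<open>torus_coeff\<close> kills, as the multiplier 1 shows.\<close>
  define \<tau> where "\<tau> c = torus_coeff \<alpha> \<beta> \<gamma> (SOME p. c = quot_proj ?A p)" for c
  have \<tau>: "\<tau> (quot_proj ?A p) = torus_coeff \<alpha> \<beta> \<gamma> p" for p
  proof -
    have "quot_proj ?A p = quot_proj ?A (SOME q. quot_proj ?A p = quot_proj ?A q)" (is "_ = quot_proj ?A ?q")
      by (rule someI) (rule refl)
    then have "p - ?q \<in> torus_kernel \<alpha> \<beta> \<gamma>"
      using torus_ideal_subset_kernel by (auto simp: quot_proj_eq_iff)
    then have "torus_coeff \<alpha> \<beta> \<gamma> (1 * (p - ?q)) = 0" unfolding torus_kernel_def by blast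
    then have "torus_coeff \<alpha> \<beta> \<gamma> p + torus_coeff \<alpha> \<beta> \<gamma> ?q = 0"
      by (simp add: laurent_minus torus_coeff_add)
    then show ?thesis unfolding \<tau>_def
      by (cases "torus_coeff \<alpha> \<beta> \<gamma> p"; cases "torus_coeff \<alpha> \<beta> \<gamma> ?q") simp_all
  qed
  show "\<tau> (x \<oplus>\<^bsub>torus \<alpha> \<beta> \<gamma>\<^esub> y) = \<tau> x + \<tau> y"
    if "x \<in> carrier (torus \<alpha> \<beta> \<gamma>)" "y \<in> carrier (torus \<alpha> \<beta> \<gamma>)" for x y
    using that unfolding torus_def carrier_laurent_quot
    by (auto simp: \<tau> torus_coeff_add simp flip: quot_proj_add)
  show "x = \<zero>\<^bsub>torus \<alpha> \<beta> \<gamma>\<^esub>"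
    if x: "x \<in> carrier (torus \<alpha> \<beta> \<gamma>)"
      and 0: "\<And>y. y \<in> carrier (torus \<alpha> \<beta> \<gamma>) \<Longrightarrow> \<tau> (x \<otimes>\<^bsub>torus \<alpha> \<beta> \<gamma>\<^esub> y) = 0" for x
  proof -
    obtain p where p: "x = quot_proj ?A p" using x by (auto simp: torus_def carrier_laurent_quot)
    have "torus_coeff \<alpha> \<beta> \<gamma> (q * p) = 0" for q
      using 0[of "quot_proj ?A q"]
      by (simp add: p torus_def quot_proj_closed \<tau> mult.commute flip: quot_proj_mult)
    then have "p \<in> torus_kernel \<alpha> \<beta> \<gamma>" by (simp add: torus_kernel_def)
    then show ?thesis
      unfolding torus_kernel_eq_ideal[OF assms] p torus_def quot_proj_eq_zero_iff .
  qed
qed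

section \<open>Counting stabilizers\<close>

lemma RDirProd_simps [simp]:
  "carrier (RDirProd R S) = carrier R \<times> carrier S"
  "x \<oplus>\<^bsub>RDirProd R S\<^esub> y = (fst x \<oplus>\<^bsub>R\<^esub> fst y, snd x \<oplus>\<^bsub>S\<^esub> snd y)"
  "\<zero>\<^bsub>RDirProd R S\<^esub> = (\<zero>\<^bsub>R\<^esub>, \<zero>\<^bsub>S\<^esub>)"
  by (simp_all add: RDirProd_def DirProd_def monoid.defs split_beta)

text \<open>Multipliers are taken in the Laurent ring instead of its quotient. The projection is
  onto, so the span is the same, and sums and antipodes can be computed on representatives.\<close>

definition stabilizer_span :: "laurent set \<Rightarrow> laurent \<Rightarrow> laurent \<Rightarrow> (laurent set \<times> laurent set) set"
  where "stabilizer_span A u v = range (\<lambda>q. (quot_proj A (q * u), quot_proj A (q * v)))"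

lemma stabilizers_eq_span:
  "X_stabilizers \<alpha> \<beta> \<gamma> f g = stabilizer_span (torus_relations \<alpha> \<beta> \<gamma>) f g"
  "Z_stabilizers \<alpha> \<beta> \<gamma> f g = stabilizer_span (torus_relations \<alpha> \<beta> \<gamma>) (antipode g) (antipode f)"
  by (auto simp: X_stabilizers_def Z_stabilizers_def stabilizer_span_def torus_def
      torus_proj_eq_quot_proj carrier_laurent_quot quot_proj_mult Let_def)

lemma ring_laurent_quot_square: "ring (RDirProd (laurent_quot A) (laurent_quot A))"
  by (intro RDirProd_ring ring_laurent_quot)

lemma laurent_quot_square_double:
  assumes "x \<in> carrier (RDirProd (laurent_quot A) (laurent_quot A))"
  shows "x \<oplus>\<^bsub>RDirProd (laurent_quot A) (laurent_quot A)\<^esub> x = \<zero>\<^bsub>RDirProd (laurent_quot A) (laurent_quot A)\<^esub>"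
  using assms by (auto simp: laurent_quot_double)

lemma (in ring) additive_subgroup_char2I:
  assumes "\<And>x. x \<in> carrier R \<Longrightarrow> x \<oplus> x = \<zero>" "H \<subseteq> carrier R" "H \<noteq> {}"
    and "\<And>x y. x \<in> H \<Longrightarrow> y \<in> H \<Longrightarrow> x \<oplus> y \<in> H"
  shows "additive_subgroup H R"
proof (rule additive_subgroupI, rule add.subgroupI)
  show "\<ominus> a \<in> H" if "a \<in> H" for a
    using that assms(1,2) minus_equality[of a a] by auto
qed (use assms in auto)

lemma additive_subgroup_stabilizer_span:
  "additive_subgroup (stabilizer_span A u v) (RDirProd (laurent_quot A) (laurent_quot A))"
proof (rule ring.additive_subgroup_char2I[OF ring_laurent_quot_square laurent_quot_square_double])
  fix x y assume "x \<in> stabilizer_span A u v" "y \<in> stabilizer_span A u v"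
  then obtain p q where
    "x = (quot_proj A (p * u), quot_proj A (p * v))" "y = (quot_proj A (q * u), quot_proj A (q * v))"
    by (auto simp: stabilizer_span_def)
  then have "x \<oplus>\<^bsub>RDirProd (laurent_quot A) (laurent_quot A)\<^esub> y
      = (quot_proj A ((p + q) * u), quot_proj A ((p + q) * v))"
    by (simp add: distrib_right quot_proj_add)
  then show "x \<oplus>\<^bsub>RDirProd (laurent_quot A) (laurent_quot A)\<^esub> y \<in> stabilizer_span A u v"
    by (auto simp: stabilizer_span_def)
qed (auto simp: stabilizer_span_def quot_proj_closed)

text \<open>An ideal stable under the antipode lets the antipode act on cosets elementwise, which
  gives a bijection between the two spans.\<close>

lemma card_stabilizer_span_antipode:
  assumes antipode_A: "antipode ` laurent_ideal A \<subseteq> laurent_ideal A"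
  shows "card (stabilizer_span A (antipode g) (antipode f)) = card (stabilizer_span A f g)"
proof -
  let ?J = "laurent_ideal A"
  \<comment> \<open>The antipode is an involution, so the assumed inclusion becomes an
    equivalence.\<close>
  have J: "antipode p \<in> ?J \<longleftrightarrow> p \<in> ?J" for p
    using antipode_A antipode_antipode by (metis image_subset_iff)
  have coset: "quot_proj A p = {q. q - p \<in> ?J}" for p
  proof -
    interpret ideal ?J laurent_ring by (rule ideal_Idl)
    show ?thesis using a_rcos_module[of p] by (auto simp: quot_proj_def)
  qed
  have image: "antipode ` quot_proj A p = quot_proj A (antipode p)" for p
  proof -
    have "q \<in> antipode ` quot_proj A p \<longleftrightarrow> antipode q \<in> quot_proj A p" for q
      by (metis antipode_antipode image_iff)
    also have "antipode q \<in> quot_proj A p \<longleftrightarrow> q \<in> quot_proj A (antipode p)" for q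
      using J[of "q - antipode p"] by (simp add: coset antipode_diff antipode_antipode)
    finally show ?thesis by blast
  qed
  \<comment> \<open>The components are exchanged because the Z-type generator is (antipode g,
    antipode f). The multiplier q turns into its antipode, which again runs over all Laurent
    polynomials.\<close>
  let ?s = "\<lambda>(c, d). (antipode ` d, antipode ` c)"
  have "inj antipode" by (metis antipode_antipode injI)
  then have "inj ?s" by (auto intro!: injI simp: inj_image_eq_iff)
  moreover have "?s ` stabilizer_span A f g = stabilizer_span A (antipode g) (antipode f)"
  proof -
    have "?s ` stabilizer_span A f g
        = (\<lambda>q. (quot_proj A (q * antipode g), quot_proj A (q * antipode f))) ` range antipode"
      by (simp add: stabilizer_span_def image_image image antipode_mult)
    moreover have "range antipode = UNIV" by (metis antipode_antipode surjI)
    ultimately show ?thesis by (simp add: stabilizer_span_def)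
  qed
  ultimately show ?thesis by (metis card_image inj_on_subset subset_UNIV)
qed

text \<open>The preimage of the ideal under the antipode is an ideal, and it contains the relations
  because the lattice is closed under negation.\<close>

lemma antipode_torus_ideal: "antipode ` torus_ideal \<alpha> \<beta> \<gamma> \<subseteq> torus_ideal \<alpha> \<beta> \<gamma>"
proof -
  let ?I = "{p. antipode p \<in> torus_ideal \<alpha> \<beta> \<gamma>}"
  note J = ideal_ring_of_type_algebraD[OF ideal_Idl[of "torus_relations \<alpha> \<beta> \<gamma>"]]
  have "ideal ?I laurent_ring"
    by (rule ideal_ring_of_type_algebraI) (auto simp: antipode_zero antipode_add antipode_mult J)
  moreover have "antipode (Poly_Mapping.single u 1 - 1) \<in> torus_ideal \<alpha> \<beta> \<gamma>"
    if "u \<in> torus_lattice \<alpha> \<beta> \<gamma>" for u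
  proof -
    have "antipode 1 = 1" using antipode_single[of 0 1] by simp
    then show ?thesis
      using single_minus_one_in_torus_ideal[OF torus_lattice_uminus[OF that]]
      by (simp only: antipode_diff antipode_single)
  qed
  then have "torus_relations \<alpha> \<beta> \<gamma> \<subseteq> ?I"
    using torus_lattice_generators by (auto simp: torus_relations_def monomial_def)
  ultimately show ?thesis using Idl_least by blast
qed

section \<open>Cardinalities of kernels, ideals and iterated quotients\<close>

definition annihilator :: "laurent set \<Rightarrow> laurent \<Rightarrow> laurent \<Rightarrow> laurent set set"
  where "annihilator A f g = quot_proj A ` {q. q * f \<in> laurent_ideal A \<and> q * g \<in> laurent_ideal A}"

text \<open>An ideal K containing the ideal of A is a union of cosets of it, so membership in K can
  be tested on any representative.\<close>

lemma quot_proj_in_image_iff: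
  assumes "ideal K laurent_ring" "laurent_ideal A \<subseteq> K"
  shows "quot_proj A p \<in> quot_proj A ` K \<longleftrightarrow> p \<in> K"
proof
  assume "quot_proj A p \<in> quot_proj A ` K"
  then obtain q where q: "q \<in> K" "p - q \<in> K"
    using assms(2) by (auto simp: quot_proj_eq_iff)
  then have "p - q + q \<in> K" using ideal_ring_of_type_algebraD(2)[OF assms(1)] by blast
  then show "p \<in> K" by simp
qed simp

lemma ideal_image_quot_proj:
  assumes "ideal K laurent_ring"
  shows "ideal (quot_proj A ` K) (laurent_quot A)"
proof -
  interpret cring "laurent_quot A" by (rule cring_laurent_quot)
  note K = ideal_ring_of_type_algebraD[OF assms]
  have "additive_subgroup (quot_proj A ` K) (laurent_quot A)"
    using K(1,2) by (intro additive_subgroup_char2I laurent_quot_double)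
      (auto simp: quot_proj_closed simp flip: quot_proj_add)
  moreover have "c \<otimes>\<^bsub>laurent_quot A\<^esub> a \<in> quot_proj A ` K" "a \<otimes>\<^bsub>laurent_quot A\<^esub> c \<in> quot_proj A ` K"
    if "a \<in> quot_proj A ` K" "c \<in> carrier (laurent_quot A)" for a c
    using that K(3) unfolding carrier_laurent_quot
    by (auto simp: mult.commute simp flip: quot_proj_mult)
  ultimately show ?thesis
    by (intro idealI ring_axioms additive_subgroup.a_subgroup) auto
qed

lemma ideal_annihilator:
  "ideal {q. q * f \<in> laurent_ideal A \<and> q * g \<in> laurent_ideal A} laurent_ring"
  using ideal_ring_of_type_algebraD[OF ideal_Idl[of A]]
  by (intro ideal_ring_of_type_algebraI) (auto simp: distrib_right mult.assoc)

lemma card_stabilizer_span_times_card_annihilator: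
  assumes "finite (carrier (laurent_quot A))"
  shows "card (stabilizer_span A f g) * card (annihilator A f g) = card (carrier (laurent_quot A))"
proof -
  let ?K = "{q. q * f \<in> laurent_ideal A \<and> q * g \<in> laurent_ideal A}"
  let ?h = "\<lambda>s. (s \<otimes>\<^bsub>laurent_quot A\<^esub> quot_proj A f, s \<otimes>\<^bsub>laurent_quot A\<^esub> quot_proj A g)"
  interpret cring "laurent_quot A" by (rule cring_laurent_quot)
  have K: "laurent_ideal A \<subseteq> ?K"
    using ideal_ring_of_type_algebraD(3)[OF ideal_Idl[of A]] by (auto simp: mult.commute)
  have "card (?h ` carrier (laurent_quot A)) * card (annihilator A f g) = card (carrier (laurent_quot A))"
  proof (rule card_image_times_card_subgroup[OF abelian_group_axioms _ assms])
    show "additive_subgroup (annihilator A f g) (laurent_quot A)"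
      unfolding annihilator_def
      by (rule ideal.axioms(1)[OF ideal_image_quot_proj[OF ideal_annihilator]])
    fix x y assume "x \<in> carrier (laurent_quot A)" "y \<in> carrier (laurent_quot A)"
    then obtain p q where pq: "x = quot_proj A p" "y = quot_proj A q"
      by (auto simp: carrier_laurent_quot)
    \<comment> \<open>The fibres of multiplication by (f, g) are the cosets of its kernel, which is
      \<open>annihilator A f g\<close>.\<close>
    have "?h x = ?h y \<longleftrightarrow> p - q \<in> ?K"
      by (simp add: pq quot_proj_eq_iff left_diff_distrib flip: quot_proj_mult)
    also have "\<dots> \<longleftrightarrow> x \<ominus>\<^bsub>laurent_quot A\<^esub> y \<in> annihilator A f g"
      unfolding pq annihilator_def a_minus_quot_proj quot_proj_in_image_iff[OF ideal_annihilator K] ..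
    finally show "?h x = ?h y \<longleftrightarrow> x \<ominus>\<^bsub>laurent_quot A\<^esub> y \<in> annihilator A f g" .
  qed
  moreover have "?h ` carrier (laurent_quot A) = stabilizer_span A f g"
    by (auto simp: carrier_laurent_quot stabilizer_span_def quot_proj_mult image_image)
  ultimately show ?thesis by simp
qed

text \<open>Third isomorphism theorem in counted form: the natural map between the two quotients is
  onto, and its kernel is the image of the larger ideal.\<close>

lemma card_quot_times_card_image_ideal:
  assumes AB: "A \<subseteq> B" and "finite (carrier (laurent_quot A))"
  shows "finite (carrier (laurent_quot B))"
    and "card (carrier (laurent_quot B)) * card (quot_proj A ` laurent_ideal B) = card (carrier (laurent_quot A))"
proof -
  interpret cring "laurent_quot A" by (rule cring_laurent_quot)
  let ?K = "laurent_ideal B"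
  have K: "laurent_ideal A \<subseteq> ?K"
    using Idl_least[OF ideal_Idl] Idl_superset AB by blast
  define h where "h c = quot_proj B (SOME p. c = quot_proj A p)" for c
  have h: "h (quot_proj A p) = quot_proj B p" for p
  proof -
    have "quot_proj A p = quot_proj A (SOME q. quot_proj A p = quot_proj A q)" (is "_ = quot_proj A ?q")
      by (rule someI) (rule refl)
    then have "quot_proj B p = quot_proj B ?q" using K by (auto simp: quot_proj_eq_iff)
    then show ?thesis by (simp add: h_def)
  qed
  have range_h: "h ` carrier (laurent_quot A) = carrier (laurent_quot B)"
    by (simp add: carrier_laurent_quot image_image h)
  then show "finite (carrier (laurent_quot B))" using assms(2) finite_imageI by metis
  have "card (h ` carrier (laurent_quot A)) * card (quot_proj A ` ?K) = card (carrier (laurent_quot A))"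
  proof (rule card_image_times_card_subgroup[OF abelian_group_axioms _ assms(2)])
    show "additive_subgroup (quot_proj A ` ?K) (laurent_quot A)"
      by (rule ideal.axioms(1)[OF ideal_image_quot_proj[OF ideal_Idl]])
    fix x y assume "x \<in> carrier (laurent_quot A)" "y \<in> carrier (laurent_quot A)"
    then obtain p q where pq: "x = quot_proj A p" "y = quot_proj A q"
      by (auto simp: carrier_laurent_quot)
    show "h x = h y \<longleftrightarrow> x \<ominus>\<^bsub>laurent_quot A\<^esub> y \<in> quot_proj A ` ?K"
      unfolding pq h a_minus_quot_proj quot_proj_in_image_iff[OF ideal_Idl K] by (rule quot_proj_eq_iff)
  qed
  then show "card (carrier (laurent_quot B)) * card (quot_proj A ` ?K) = card (carrier (laurent_quot A))"
    by (simp add: range_h)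
qed

text \<open>Links the kernel of multiplication by (f, g) to the annihilator in the duality count.
  For fixed q the p with p q in the ideal of A form an ideal that already contains A, so only f and
  g have to be tested.\<close>

lemma annihilator_eq:
  "annihilator A f g = {b \<in> carrier (laurent_quot A).
    \<forall>a \<in> quot_proj A ` laurent_ideal ({f, g} \<union> A). a \<otimes>\<^bsub>laurent_quot A\<^esub> b = \<zero>\<^bsub>laurent_quot A\<^esub>}"
    (is "_ = {b \<in> _. \<forall>a \<in> quot_proj A ` ?K. _}")
proof -
  note J = ideal_ring_of_type_algebraD[OF ideal_Idl[of A]]
  have "(\<forall>p\<in>?K. p * q \<in> laurent_ideal A)
      \<longleftrightarrow> q * f \<in> laurent_ideal A \<and> q * g \<in> laurent_ideal A" for q
  proof
    assume "\<forall>p\<in>?K. p * q \<in> laurent_ideal A"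
    then show "q * f \<in> laurent_ideal A \<and> q * g \<in> laurent_ideal A"
      using Idl_superset[of "{f, g} \<union> A"] by (auto simp: mult.commute)
  next
    assume fg: "q * f \<in> laurent_ideal A \<and> q * g \<in> laurent_ideal A"
    have "ideal {p. p * q \<in> laurent_ideal A} laurent_ring"
      using J by (intro ideal_ring_of_type_algebraI) (auto simp: distrib_right mult.assoc)
    moreover have "{f, g} \<union> A \<subseteq> {p. p * q \<in> laurent_ideal A}"
      using fg J(3) Idl_superset[of A] by (auto simp: mult.commute)
    ultimately show "\<forall>p\<in>?K. p * q \<in> laurent_ideal A" using Idl_least by blast
  qed
  moreover have "(\<forall>a \<in> quot_proj A ` ?K. a \<otimes>\<^bsub>laurent_quot A\<^esub> quot_proj A q = \<zero>\<^bsub>laurent_quot A\<^esub>)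
      \<longleftrightarrow> (\<forall>p\<in>?K. p * q \<in> laurent_ideal A)" for q
    by (simp add: quot_proj_eq_zero_iff flip: quot_proj_mult)
  ultimately show ?thesis
    unfolding annihilator_def carrier_laurent_quot by blast
qed

theorem theorem3:
  fixes f g :: laurent and \<alpha> \<beta> \<gamma> :: int
  assumes "\<alpha> \<ge> 1" and "\<beta> \<ge> 1"
  defines "Q \<equiv> laurent_quot {f, g, monomial 0 \<alpha> - 1, monomial \<beta> \<gamma> - 1}"
  shows "logical_dimension \<alpha> \<beta> \<gamma> f g = 2 * int (dim_Z2 Q (carrier Q))"
proof -
  define A where "A = torus_relations \<alpha> \<beta> \<gamma>"
  define S where "S = laurent_quot A"
  define I where "I = quot_proj A ` laurent_ideal ({f, g} \<union> A)"
  define N where "N = nat (\<alpha> * \<beta>)"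
  have torus: "torus \<alpha> \<beta> \<gamma> = S" by (simp add: torus_def S_def A_def)
  have finS: "finite (carrier S)" and cardS: "card (carrier S) = 2 ^ N"
    using card_carrier_torus[OF assms(1,2), of \<gamma>] by (simp_all add: torus N_def)
  have Q: "Q = laurent_quot ({f, g} \<union> A)"
    by (simp add: Q_def A_def torus_relations_def insert_commute)
  let ?X = "stabilizer_span A f g" and ?Z = "stabilizer_span A (antipode g) (antipode f)"
  let ?S2 = "RDirProd S S"
  have card_span: "card (stabilizer_span A u v) = 2 ^ dim_Z2 ?S2 (stabilizer_span A u v)" for u v
    unfolding S_def
  proof (rule card_eq_two_power_dim_Z2[OF ring_laurent_quot_square laurent_quot_square_double
        additive_subgroup_stabilizer_span])
    have "stabilizer_span A u v \<subseteq> carrier S \<times> carrier S"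
      by (auto simp: stabilizer_span_def S_def quot_proj_closed)
    then show "finite (stabilizer_span A u v)" using finS finite_subset by blast
  qed
  obtain \<tau> :: "laurent set \<Rightarrow> bit" where \<tau>:
    "\<And>x y. x \<in> carrier S \<Longrightarrow> y \<in> carrier S \<Longrightarrow> \<tau> (x \<oplus>\<^bsub>S\<^esub> y) = \<tau> x + \<tau> y"
    "\<And>x. x \<in> carrier S \<Longrightarrow> (\<And>y. y \<in> carrier S \<Longrightarrow> \<tau> (x \<otimes>\<^bsub>S\<^esub> y) = 0) \<Longrightarrow> x = \<zero>\<^bsub>S\<^esub>"
    using torus_nondegenerate_functional[OF assms(1,2), of \<gamma>] unfolding torus by blast
  have I: "card I * card (annihilator A f g) = 2 ^ N"
  proof -
    have "card I * card {b \<in> carrier S. \<forall>a\<in>I. a \<otimes>\<^bsub>S\<^esub> b = \<zero>\<^bsub>S\<^esub>} = card (carrier S)"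
    proof (rule cring.card_ideal_times_card_annihilator[where \<tau> = \<tau>])
      show "cring S" unfolding S_def by (rule cring_laurent_quot)
      show "ideal I S" unfolding S_def I_def by (rule ideal_image_quot_proj[OF ideal_Idl])
    qed (fact finS \<tau>)+
    then show ?thesis by (simp only: annihilator_eq flip: S_def I_def cardS)
  qed
  have X: "card ?X * card (annihilator A f g) = 2 ^ N"
    using card_stabilizer_span_times_card_annihilator[of A f g] finS cardS
    by (simp only: S_def)
  have QI: "finite (carrier Q)" "card (carrier Q) * card I = 2 ^ N"
    using card_quot_times_card_image_ideal[OF Un_upper2[of A "{f, g}"]] finS cardS
    unfolding Q I_def S_def by simp_all
  have "card (carrier Q) = 2 ^ dim_Z2 Q (carrier Q)"
  proof (rule card_eq_two_power_dim_Z2)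
    show "ring Q" "\<And>x. x \<in> carrier Q \<Longrightarrow> x \<oplus>\<^bsub>Q\<^esub> x = \<zero>\<^bsub>Q\<^esub>"
      by (simp_all add: Q ring_laurent_quot laurent_quot_double)
    then show "additive_subgroup (carrier Q) Q"
      by (intro ring.additive_subgroup_char2I) (auto intro: ring.ring_simprules ring.ring_simprules(2))
  qed (rule QI(1))
  \<comment> \<open>Both numbers have the same product with the size of the annihilator, which is
    nonzero since that product is a power of two.\<close>
  moreover have "card ?X = card I"
  proof -
    have "card (annihilator A f g) \<noteq> 0" using I by (intro notI) simp
    then show ?thesis using I X by (metis mult_cancel2)
  qed
  ultimately have "(2 :: nat) ^ (dim_Z2 Q (carrier Q) + dim_Z2 ?S2 ?X) = 2 ^ N"
    using QI(2) card_span[of f g] by (simp add: power_add)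
  then have N: "dim_Z2 Q (carrier Q) + dim_Z2 ?S2 ?X = N" by simp
  have "card ?Z = card ?X"
    using card_stabilizer_span_antipode antipode_torus_ideal unfolding A_def by blast
  then have "(2 :: nat) ^ dim_Z2 ?S2 ?Z = 2 ^ dim_Z2 ?S2 ?X" using card_span by metis
  then have "dim_Z2 ?S2 ?Z = dim_Z2 ?S2 ?X" by simp
  moreover have "\<alpha> * \<beta> = int N" using assms by (simp add: N_def)
  \<comment> \<open>With d the dimension of Q, both stabilizer spaces have dimension N - d, so k = 2
    N - 2 (N - d) = 2 d.\<close>
  ultimately show ?thesis
    using N by (simp add: logical_dimension_def num_qubits_def stabilizers_eq_span torus
        flip: A_def)
qed

end
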